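(* For every integer $t>3$, the graph obtained from the complete bipartite graph $K_{t,t}$ by deleting the edges of a perfect matching is not norming.
   Context: Let $\mathcal{W}$ be the real vector space of symmetric bounded measurable functions $W:[0,1]^2\to\mathbb{R}$. For a graph $H$ and $W\in\mathcal{W}$, $t_H(W)=\int_{[0,1]^{V(H)}}\prod_{ij\in E(H)}W(x_i,x_j)\,d\mu^{v(H)}$, with $\mu$ Lebesgue measure. Set $\|W\|_H:=|t_H(W)|^{1/e(H)}$. A graph $H$ is norming if $\|\cdot\|_H$ is a norm on $\mathcal{W}$. *)

theory Defs
  imports "HOL-Analysis.Analysis"
begin

text \<open>A graph is a pair of a vertex set and a set of edges, each edge being a two-element
  set of vertices.\<close>

type_synonym 'a ugraph = "'a set \<times> 'a set set"

abbreviation vertices :: "'a ugraph \<Rightarrow> 'a set" where "vertices H \<equiv> fst H"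
abbreviation edges :: "'a ugraph \<Rightarrow> 'a set set" where "edges H \<equiv> snd H"

definition complete_bipartite :: "'a set \<Rightarrow> 'a set \<Rightarrow> 'a ugraph" where
  "complete_bipartite A B = (A \<union> B, {{a, b} | a b. a \<in> A \<and> b \<in> B})"

definition perfect_matching :: "'a ugraph \<Rightarrow> 'a set set \<Rightarrow> bool" where
  "perfect_matching H M \<longleftrightarrow> M \<subseteq> edges H \<and> (\<forall>v\<in>vertices H. \<exists>!e. e \<in> M \<and> v \<in> e)"

definition delete_edges :: "'a ugraph \<Rightarrow> 'a set set \<Rightarrow> 'a ugraph" where
  "delete_edges H M = (vertices H, edges H - M)"

abbreviation unit_measure :: "real measure" where
  "unit_measure \<equiv> restrict_space lborel {0..1}"

text \<open>Only the values on the unit square matter. Measurability is Borel measurability: with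
  it the integrand of \<open>t_H\<close> below is measurable for the product sigma-algebra, and every
  Lebesgue measurable kernel agrees almost everywhere with a Borel measurable one.\<close>

definition kernels :: "(real \<times> real \<Rightarrow> real) set" where
  "kernels = {W. W \<in> borel_measurable (unit_measure \<Otimes>\<^sub>M unit_measure)
      \<and> (\<exists>C. \<forall>x\<in>{0..1}. \<forall>y\<in>{0..1}. \<bar>W (x, y)\<bar> \<le> C)
      \<and> (\<forall>x\<in>{0..1}. \<forall>y\<in>{0..1}. W (x, y) = W (y, x))}"

text \<open>The value of \<open>W\<close> at the unordered edge \<open>e = {i, j}\<close>; it is well defined for
  symmetric \<open>W\<close>.\<close>

definition edge_value :: "(real \<times> real \<Rightarrow> real) \<Rightarrow> ('a \<Rightarrow> real) \<Rightarrow> 'a set \<Rightarrow> real" where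
  "edge_value W x e = (THE w. \<exists>i j. e = {i, j} \<and> w = W (x i, x j))"

lemma edge_value_pair:
  assumes "W \<in> kernels" "x i \<in> {0..1}" "x j \<in> {0..1}"
  shows "edge_value W x {i, j} = W (x i, x j)"
proof -
  have "W (x i, x j) = W (x j, x i)"
    using assms unfolding kernels_def by blast
  then show ?thesis
    unfolding edge_value_def by (intro the_equality) (auto simp: doubleton_eq_iff)
qed

definition t_H :: "'a ugraph \<Rightarrow> (real \<times> real \<Rightarrow> real) \<Rightarrow> real" where
  "t_H H W = (LINT x | (\<Pi>\<^sub>M i\<in>vertices H. unit_measure). (\<Prod>e\<in>edges H. edge_value W x e))"

definition norm_H :: "'a ugraph \<Rightarrow> (real \<times> real \<Rightarrow> real) \<Rightarrow> real" where
  "norm_H H W = \<bar>t_H H W\<bar> powr (1 / real (card (edges H)))"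

text \<open>As usual for function spaces, functions that agree almost everywhere are identified, so
  definiteness is required modulo null sets.\<close>

definition is_norm_ae :: "'b measure \<Rightarrow> ('b \<Rightarrow> real) set \<Rightarrow> (('b \<Rightarrow> real) \<Rightarrow> real) \<Rightarrow> bool" where
  "is_norm_ae M S N \<longleftrightarrow>
     (\<forall>f\<in>S. 0 \<le> N f)
   \<and> (\<forall>f\<in>S. N f = 0 \<longleftrightarrow> (AE p in M. f p = 0))
   \<and> (\<forall>f\<in>S. \<forall>c. N (\<lambda>p. c * f p) = \<bar>c\<bar> * N f)
   \<and> (\<forall>f\<in>S. \<forall>g\<in>S. N (\<lambda>p. f p + g p) \<le> N f + N g)"

definition norming :: "'a ugraph \<Rightarrow> bool" where
  "norming H \<longleftrightarrow> is_norm_ae (unit_measure \<Otimes>\<^sub>M unit_measure) kernels (norm_H H)"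

end

theory Submission
  imports Defs
begin

text \<open>
  Write \<open>A\<close> for one side of the graph, so that both sides are indexed by \<open>A\<close> and \<open>i\<close> is joined to
  the partner of \<open>j\<close> iff \<open>i \<noteq> j\<close>; every degree is \<open>d = t - 1\<close>. If \<open>d\<close> is odd, the kernel
  \<open>\<sigma>(x) \<sigma>(y)\<close> with a balanced sign \<open>\<sigma>\<close> has density zero.

  If \<open>d\<close> is even, multiplying a kernel by \<open>s(x) s(y)\<close> with a sign \<open>s\<close> does not change its density.
  Averaging a kernel with its sign change on a part \<open>P\<close> deletes the entries between \<open>P\<close> and its
  complement, hence for a norming graph this deletion cannot increase the norm. The test kernel
  has three parts and vanishes on \<open>P \<times> P\<close>; on the other two parts it is \<open>1, 1, 1, - 1\<close>. If \<open>P\<close> has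
  measure \<open>z\<close>, the density is a polynomial in \<open>z\<close> whose linear coefficient sums over the maps
  sending exactly one vertex to \<open>P\<close>. For \<open>d \<ge> 4\<close> this coefficient can be made negative, whereas
  the constant term is positive: for small \<open>z\<close>, deleting the entries increases the norm.
\<close>

section \<open>Densities as sums over maps into three parts\<close>

text \<open>The density of a three-step kernel, for part measures that may depend on the vertex. Such
  measures make the sum multi-affine, so that its derivatives are sums of the same kind.\<close>

definition crown_sum ::
    "'a set \<Rightarrow> ('a \<Rightarrow> nat \<Rightarrow> real) \<Rightarrow> ('a \<Rightarrow> nat \<Rightarrow> real) \<Rightarrow> (nat \<Rightarrow> nat \<Rightarrow> real) \<Rightarrow> real" where
  "crown_sum A u w K =
     (\<Sum>f\<in>A \<rightarrow>\<^sub>E {..<3}. \<Sum>g\<in>A \<rightarrow>\<^sub>E {..<3}.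
        (\<Prod>i\<in>A. u i (f i)) * (\<Prod>j\<in>A. w j (g j)) * (\<Prod>i\<in>A. \<Prod>j\<in>A - {i}. K (f i) (g j)))"

lemma prod_off_diagonal_swap:
  fixes F :: "'a \<Rightarrow> 'a \<Rightarrow> real"
  assumes "finite A"
  shows "(\<Prod>i\<in>A. \<Prod>j\<in>A - {i}. F i j) = (\<Prod>j\<in>A. \<Prod>i\<in>A - {j}. F i j)"
proof -
  have "A - {i} = {j\<in>A. i \<noteq> j}" "A - {i} = {j\<in>A. j \<noteq> i}" for i
    by auto
  then show ?thesis
    using prod.swap_restrict[OF assms assms, of F "(\<noteq>)"] by simp
qed

text \<open>Once \<open>f\<close> is fixed, the vertices of the other side do not interact, so the
  sum over \<open>g\<close> splits into one small sum for each \<open>j\<close>.\<close>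

lemma crown_sum_factor:
  assumes "finite A"
  shows "crown_sum A u w K =
    (\<Sum>f\<in>A \<rightarrow>\<^sub>E {..<3}. (\<Prod>i\<in>A. u i (f i)) * (\<Prod>j\<in>A. \<Sum>y<3. w j y * (\<Prod>i\<in>A - {j}. K (f i) y)))"
proof -
  have "(\<Prod>j\<in>A. \<Sum>y<3. w j y * (\<Prod>i\<in>A - {j}. K (f i) y))
      = (\<Sum>g\<in>A \<rightarrow>\<^sub>E {..<3}. (\<Prod>j\<in>A. w j (g j)) * (\<Prod>i\<in>A. \<Prod>j\<in>A - {i}. K (f i) (g j)))" for f
    using assms by (subst prod_off_diagonal_swap) (simp_all add: prod_sum_PiE prod.distrib)
  then show ?thesis
    unfolding crown_sum_def by (simp add: sum_distrib_left mult.assoc)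
qed

text \<open>Being off the diagonal is a symmetric relation, so exchanging the two sides of the graph
  only transposes \<open>K\<close>.\<close>

lemma crown_sum_swap:
  assumes "finite A" and "\<And>x y. K x y = K y x"
  shows "crown_sum A u w K = crown_sum A w u K"
proof -
  have *: "(\<Prod>i\<in>A. \<Prod>j\<in>A - {i}. K (f i) (g j)) = (\<Prod>i\<in>A. \<Prod>j\<in>A - {i}. K (g i) (f j))" for f g
    by (subst prod_off_diagonal_swap[OF assms(1)]) (intro prod.cong refl assms(2))
  show ?thesis
    unfolding crown_sum_def by (subst sum.swap, subst *) (simp add: mult.commute)
qed

lemma crown_sum_scale:
  "crown_sum A (\<lambda>_ k. c * u k) (\<lambda>_ k. c * w k) K
     = c ^ (2 * card A) * crown_sum A (\<lambda>_. u) (\<lambda>_. w) K"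
  unfolding crown_sum_def sum_distrib_left
  by (intro sum.cong refl) (simp add: prod.distrib mult_2 power_add)

text \<open>The sign of each vertex occurs once for every incident edge, that is
  \<open>card A - 1\<close> times, and an even power of a sign is \<open>1\<close>.\<close>

lemma crown_sum_sign:
  assumes "finite A" and "even (card A - 1)" and s: "\<And>k. \<bar>s k\<bar> = 1"
  shows "crown_sum A u w (\<lambda>x y. s x * s y * K x y) = crown_sum A u w K"
proof -
  have s2: "s k ^ (card A - 1) = 1" for k
    by (metis assms(2) power_even_abs power_one s)
  have A: "(\<Prod>i\<in>A. \<Prod>j\<in>A - {i}. s (f i)) = 1" for f
    using assms(1) s2 by (auto intro: prod.neutral)
  have B: "(\<Prod>i\<in>A. \<Prod>j\<in>A - {i}. s (f j)) = 1" for f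
    by (subst prod_off_diagonal_swap[OF assms(1)]) (rule A)
  show ?thesis
    unfolding crown_sum_def prod.distrib A B by simp
qed

section \<open>The test kernel: constant and linear coefficient\<close>

text \<open>With parts \<open>1\<close> and \<open>2\<close> in proportion \<open>1 : 8\<close>, the entries \<open>72\<close> and \<open>7\<close> satisfy
  \<open>72 + 8 * 7 = 8 * (72 - 8 * 7)\<close>, which makes all positive terms of the linear coefficient equal.\<close>

definition test_kernel :: "nat \<Rightarrow> nat \<Rightarrow> real" where
  "test_kernel x y =
     (if x = 0 \<and> y = 0 then 0
      else if x = 0 \<or> y = 0 then (if x = 1 \<or> y = 1 then 72 else 7)
      else if x = 1 \<or> y = 1 then 1 else - 1)"

definition test_weight :: "real \<Rightarrow> nat \<Rightarrow> real" where
  "test_weight z k = (if k = 0 then z else if k = 1 then 1 else 8)"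

text \<open>On parts \<open>1\<close> and \<open>2\<close> this is the column
  \<open>test_kernel _ 2\<close>. The value \<open>1\<close> at part \<open>0\<close> lets a vertex
  placed there drop out of products of signs.\<close>

definition parity_sign :: "nat \<Rightarrow> real" where
  "parity_sign k = (if k = 2 then - 1 else 1)"

lemma test_kernel_sym: "test_kernel x y = test_kernel y x"
  by (auto simp: test_kernel_def)

lemma sum_lessThan_3: "(\<Sum>y<3. F y) = F 0 + F 1 + F (2::nat)" for F :: "nat \<Rightarrow> real"
  by (simp add: numeral_eq_Suc)

lemma prod_parity_sign_cases:
  "(\<Prod>i\<in>A. parity_sign (f i)) = 1 \<or> (\<Prod>i\<in>A. parity_sign (f i)) = - 1"
  by (induction A rule: infinite_finite_induct) (auto simp: parity_sign_def)

lemma prod_parity_sign_remove: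
  assumes "finite A" "j \<in> A"
  shows "(\<Prod>i\<in>A - {j}. parity_sign (f i)) = (\<Prod>i\<in>A. parity_sign (f i)) * parity_sign (f j)"
  using prod.remove[OF assms, of "\<lambda>i. parity_sign (f i)"] by (auto simp: parity_sign_def)

text \<open>At \<open>z = 0\<close> only maps into parts \<open>1\<close> and \<open>2\<close> have
  nonzero weight. For each such \<open>f\<close> the sum over all \<open>g\<close> is positive,
  because the signs of its factors cancel when \<open>card A\<close> is odd.\<close>

lemma crown_sum_test_pos:
  fixes A :: "'a set"
  assumes A: "finite A" "odd (card A)"
  shows "crown_sum A (\<lambda>_. test_weight 0) (\<lambda>_. test_weight 0) test_kernel > 0"
proof -
  define T where "T f = (\<Prod>i\<in>A. test_weight 0 (f i)) *
    (\<Prod>j\<in>A. \<Sum>y<3. test_weight 0 y * (\<Prod>i\<in>A - {j}. test_kernel (f i) y))" for f :: "'a \<Rightarrow> nat"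
  have pos: "T f > 0" if f: "f \<in> A \<rightarrow>\<^sub>E {1, 2}" for f
  proof -
    define P where "P = (\<Prod>i\<in>A. parity_sign (f i))"
    have f12: "f i = 1 \<or> f i = 2" if "i \<in> A" for i
      using f that by (auto simp: PiE_iff)
    have P: "P = 1 \<or> P = - 1"
      unfolding P_def by (rule prod_parity_sign_cases)
    have R: "(\<Sum>y<3. test_weight 0 y * (\<Prod>i\<in>A - {j}. test_kernel (f i) y))
        = 1 + 8 * (P * parity_sign (f j))" if j: "j \<in> A" for j
    proof -
      have "(\<Prod>i\<in>A - {j}. test_kernel (f i) 1) = 1"
        using f12 by (intro prod.neutral) (fastforce simp: test_kernel_def)
      moreover have "(\<Prod>i\<in>A - {j}. test_kernel (f i) 2) = (\<Prod>i\<in>A - {j}. parity_sign (f i))"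
        using f12 by (intro prod.cong refl) (fastforce simp: test_kernel_def parity_sign_def)
      ultimately show ?thesis
        by (simp add: sum_lessThan_3 test_weight_def prod_parity_sign_remove[OF A(1) j] P_def)
    qed
    have "T f = (\<Prod>j\<in>A. test_weight 0 (f j) * (1 + 8 * (P * parity_sign (f j))))"
      unfolding T_def prod.distrib by (simp add: R)
    \<comment> \<open>For a sign \<open>e\<close> one has \<open>1 + 8 * e = e * (8 + e)\<close>.
      The factors \<open>e\<close> pulled out multiply to \<open>P ^ (card A + 1)\<close>, an even
      power.\<close>
    also have "\<dots> = (\<Prod>j\<in>A. (P * parity_sign (f j)) *
        (test_weight 0 (f j) * (8 + P * parity_sign (f j))))"
      using P by (intro prod.cong refl) (auto simp: parity_sign_def)
    also have "\<dots> = P ^ card A * P * (\<Prod>j\<in>A. test_weight 0 (f j) * (8 + P * parity_sign (f j)))"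
      by (simp add: prod.distrib P_def)
    also have "P ^ card A * P = 1"
      using P A(2) by auto
    finally have "T f = (\<Prod>j\<in>A. test_weight 0 (f j) * (8 + P * parity_sign (f j)))"
      by simp
    also have "\<dots> > 0"
      using P f12 by (intro prod_pos) (force simp: parity_sign_def test_weight_def)
    finally show ?thesis .
  qed
  have "crown_sum A (\<lambda>_. test_weight 0) (\<lambda>_. test_weight 0) test_kernel
      = (\<Sum>f\<in>A \<rightarrow>\<^sub>E {..<3}. T f)"
    unfolding crown_sum_factor[OF A(1)] T_def ..
  also have "\<dots> = (\<Sum>f\<in>A \<rightarrow>\<^sub>E {1, 2}. T f)"
  proof (rule sum.mono_neutral_right)
    show "\<forall>f\<in>(A \<rightarrow>\<^sub>E {..<3}) - (A \<rightarrow>\<^sub>E {1, 2}). T f = 0"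
    proof
      fix f :: "'a \<Rightarrow> nat" assume "f \<in> (A \<rightarrow>\<^sub>E {..<3}) - (A \<rightarrow>\<^sub>E {1, 2})"
      then obtain i where "i \<in> A" "f i < 3" "f i \<noteq> 1" "f i \<noteq> 2"
        by (auto simp: PiE_iff)
      then have "i \<in> A" "f i = 0"
        by auto
      then show "T f = 0"
        using A(1) by (force simp: T_def test_weight_def)
    qed
    show "A \<rightarrow>\<^sub>E {1, 2} \<subseteq> A \<rightarrow>\<^sub>E {..<3::nat}"
      by (intro PiE_mono) auto
  qed (use A in \<open>auto simp: finite_PiE\<close>)
  also have "\<dots> > 0"
    using A(1) by (intro sum_pos pos) (auto simp: finite_PiE PiE_eq_empty_iff)
  finally show ?thesis .
qed

text \<open>The weight at \<open>v\<close> is the derivative of \<open>test_weight z\<close> in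
  \<open>z\<close>, so this is the contribution of \<open>v\<close> to the linear coefficient:
  \<open>v\<close> lies in part \<open>0\<close> and all other vertices lie in parts
  \<open>1\<close> and \<open>2\<close>.\<close>

lemma crown_sum_test_neg:
  fixes A :: "'a set"
  assumes A: "finite A" "odd (card A)" "card A > 3" and v: "v \<in> A"
  shows "crown_sum A (\<lambda>i. if i = v then (\<lambda>k. of_bool (k = 0)) else test_weight 0)
    (\<lambda>_. test_weight 0) test_kernel < 0"
proof -
  define d where "d = card A - 1"
  have d: "d \<ge> 4" "even d" "card (A - {v}) = d"
    using A v by (auto simp: d_def card_Diff_singleton) presburger
  define T where "T f = (\<Prod>i\<in>A. (if i = v then (\<lambda>k. of_bool (k = 0)) else test_weight 0) (f i)) *
    (\<Prod>j\<in>A. \<Sum>y<3. test_weight 0 y * (\<Prod>i\<in>A - {j}. test_kernel (f i) y))" for f :: "'a \<Rightarrow> nat"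
  \<comment> \<open>The support of \<open>T\<close>.\<close>
  define S where "S = (\<Pi>\<^sub>E i\<in>A. if i = v then {0} else {1, 2::nat})"
  have S: "finite S" "card S = 2 ^ d"
  proof -
    show "finite S"
      unfolding S_def using A(1) by (intro finite_PiE) auto
    have "card S = (\<Prod>i\<in>A. if i = v then 1 else 2)"
      unfolding S_def card_PiE[OF A(1)] by (intro prod.cong) auto
    also have "\<dots> = 2 ^ d"
      using A(1) v d(3) by (simp add: prod.remove[of A v])
    finally show "card S = 2 ^ d" .
  qed
  \<comment> \<open>The partner of \<open>v\<close> is not joined to \<open>v\<close> and
    contributes \<open>1 + 8 * P\<close>, the only factor that can be negative. Every other
    \<open>j\<close> sees \<open>v\<close> through the entry \<open>72\<close> or \<open>7\<close>,
    which gives \<open>72 + 8 * 7 * (P * parity_sign (f j))\<close>.\<close>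
  have T_eq: "T f = (1 + 8 * P) * (\<Prod>j\<in>A - {v}. test_weight 0 (f j) * (72 + 56 * (P * parity_sign (f j))))"
    if f: "f \<in> S" and P: "P = (\<Prod>i\<in>A. parity_sign (f i))" for f P
  proof -
    have fv: "f v = 0" and f12: "\<And>i. i \<in> A \<Longrightarrow> i \<noteq> v \<Longrightarrow> f i = 1 \<or> f i = 2"
      using f v by (auto simp: S_def PiE_iff split: if_splits)
    have k1: "(\<Prod>i\<in>A - {v} - {j}. test_kernel (f i) 1) = 1" for j
      using f12 by (intro prod.neutral) (fastforce simp: test_kernel_def)
    have k2: "(\<Prod>i\<in>A - {v} - {j}. test_kernel (f i) 2) = (\<Prod>i\<in>A - {v} - {j}. parity_sign (f i))" for j
      using f12 by (intro prod.cong refl) (fastforce simp: test_kernel_def parity_sign_def)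
    have Rv: "(\<Sum>y<3. test_weight 0 y * (\<Prod>i\<in>A - {v}. test_kernel (f i) y)) = 1 + 8 * P"
      using k1[of v] k2[of v] prod_parity_sign_remove[OF A(1) v, of f] fv
      by (simp add: sum_lessThan_3 test_weight_def P parity_sign_def)
    have Rj: "(\<Sum>y<3. test_weight 0 y * (\<Prod>i\<in>A - {j}. test_kernel (f i) y))
        = 72 + 56 * (P * parity_sign (f j))" if j: "j \<in> A - {v}" for j
    proof -
      have *: "(\<Prod>i\<in>A - {j}. F i) = F v * (\<Prod>i\<in>A - {v} - {j}. F i)" for F :: "'a \<Rightarrow> real"
      proof -
        have "A - {j} - {v} = A - {v} - {j}"
          by auto
        then show ?thesis
          using prod.remove[of "A - {j}" v F] A(1) v j by auto
      qed
      have "(\<Prod>i\<in>A - {v} - {j}. parity_sign (f i)) = P * parity_sign (f j)"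
        using prod_parity_sign_remove[OF A(1), of j f] fv j unfolding * P
        by (simp add: parity_sign_def)
      moreover have "test_kernel (f v) 1 = 72" "test_kernel (f v) 2 = 7"
        by (simp_all add: fv test_kernel_def)
      ultimately show ?thesis
        unfolding sum_lessThan_3 * k1 k2 by (simp add: test_weight_def)
    qed
    have "(\<Prod>j\<in>A. \<Sum>y<3. test_weight 0 y * (\<Prod>i\<in>A - {j}. test_kernel (f i) y))
        = (1 + 8 * P) * (\<Prod>j\<in>A - {v}. 72 + 56 * (P * parity_sign (f j)))"
      unfolding prod.remove[OF A(1) v] Rv using Rj by simp
    moreover have "(\<Prod>i\<in>A. (if i = v then (\<lambda>k. of_bool (k = 0)) else test_weight 0) (f i))
        = (\<Prod>i\<in>A - {v}. test_weight 0 (f i))"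
      unfolding prod.remove[OF A(1) v] using fv by simp
    ultimately show ?thesis
      unfolding T_def prod.distrib by simp
  qed
  \<comment> \<open>One negative term, that of \<open>h\<close> below, outweighs all of the at most \<open>2 ^ d\<close> positive ones.\<close>
  have T_le: "T f \<le> 9 * 128 ^ d" if f: "f \<in> S" for f
  proof -
    define P where "P = (\<Prod>i\<in>A. parity_sign (f i))"
    note T = T_eq[OF f P_def]
    have f12: "f i = 1 \<or> f i = 2" if "i \<in> A - {v}" for i
      using f that by (auto simp: S_def PiE_iff split: if_splits)
    consider "P = 1" | "P = - 1"
      using prod_parity_sign_cases[of f A] unfolding P_def by blast
    then show ?thesis
    proof cases
      case 1
      have "(\<Prod>j\<in>A - {v}. test_weight 0 (f j) * (72 + 56 * (P * parity_sign (f j)))) = (\<Prod>j\<in>A - {v}. 128)"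
        using f12 1 by (intro prod.cong refl) (force simp: test_weight_def parity_sign_def)
      then show ?thesis
        unfolding T using 1 d(3) by simp
    next
      case 2
      have "(\<Prod>j\<in>A - {v}. test_weight 0 (f j) * (72 + 56 * (P * parity_sign (f j)))) \<ge> 0"
        using 2 by (intro prod_nonneg) (auto simp: test_weight_def parity_sign_def)
      then have "T f \<le> 0"
        unfolding T using 2 by simp
      then show ?thesis
        by (rule order_trans) simp
    qed
  qed
  obtain k where k: "k \<in> A" "k \<noteq> v"
    using d by (cases "A - {v} = {}") auto
  \<comment> \<open>The total sign must be \<open>- 1\<close>, and \<open>d - 1\<close> is odd: one
    vertex goes to part \<open>1\<close> with factor \<open>72 - 56 = 16\<close>, the other
    \<open>d - 1\<close> go to part \<open>2\<close> with factor
    \<open>8 * (72 + 56) = 1024\<close>. The partner of \<open>v\<close> gives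
    \<open>1 - 8 = - 7\<close>.\<close>
  define h where "h = (\<lambda>i\<in>A. if i = v then 0 else if i = k then 1 else 2::nat)"
  have h: "h \<in> S"
    by (auto simp: h_def S_def)
  have card_vk: "card (A - {v} - {k}) = d - 1"
    using d k A(1) by (simp add: card_Diff_singleton)
  have Ph: "(\<Prod>i\<in>A. parity_sign (h i)) = - 1"
  proof -
    have "(\<Prod>i\<in>A. parity_sign (h i)) = (\<Prod>i\<in>A - {v} - {k}. parity_sign (h i))"
      using A(1) v k by (simp add: prod.remove[of A v] prod.remove[of "A - {v}" k] h_def parity_sign_def)
    also have "\<dots> = (\<Prod>i\<in>A - {v} - {k}. - 1)"
      by (intro prod.cong refl) (auto simp: h_def parity_sign_def)
    also have "\<dots> = - 1"
      using card_vk d by simp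
    finally show ?thesis .
  qed
  have Th: "T h = - (112 * 1024 ^ (d - 1))"
  proof -
    have "(\<Prod>j\<in>A - {v}. test_weight 0 (h j) * (72 + 56 * (- 1 * parity_sign (h j))))
        = 16 * (\<Prod>j\<in>A - {v} - {k}. test_weight 0 (h j) * (72 + 56 * (- 1 * parity_sign (h j))))"
      using A(1) k by (simp add: prod.remove[of "A - {v}" k] h_def parity_sign_def test_weight_def)
    also have "(\<Prod>j\<in>A - {v} - {k}. test_weight 0 (h j) * (72 + 56 * (- 1 * parity_sign (h j))))
        = (\<Prod>j\<in>A - {v} - {k}. 1024)"
      by (intro prod.cong refl) (auto simp: h_def parity_sign_def test_weight_def)
    finally show ?thesis
      using T_eq[OF h Ph[symmetric]] card_vk by simp
  qed
  have "crown_sum A (\<lambda>i. if i = v then (\<lambda>k. of_bool (k = 0)) else test_weight 0)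
      (\<lambda>_. test_weight 0) test_kernel = (\<Sum>f\<in>A \<rightarrow>\<^sub>E {..<3}. T f)"
    unfolding crown_sum_factor[OF A(1)] T_def ..
  also have "\<dots> = (\<Sum>f\<in>S. T f)"
  proof (rule sum.mono_neutral_right)
    show "\<forall>f\<in>(A \<rightarrow>\<^sub>E {..<3}) - S. T f = 0"
    proof
      fix f assume f: "f \<in> (A \<rightarrow>\<^sub>E {..<3}) - S"
      then obtain i where i: "i \<in> A" "f i < 3" "f i \<notin> (if i = v then {0} else {1, 2})"
        by (auto simp: PiE_iff S_def)
      then have "(if i = v then (\<lambda>k. of_bool (k = 0)) else test_weight 0) (f i) = 0"
        by (auto simp: test_weight_def split: if_splits)
      then have "(\<Prod>i\<in>A. (if i = v then (\<lambda>k. of_bool (k = 0)) else test_weight 0) (f i)) = 0"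
        using A(1) i(1) by (intro prod_zero bexI)
      then show "T f = 0"
        unfolding T_def by simp
    qed
    show "S \<subseteq> A \<rightarrow>\<^sub>E {..<3}"
      unfolding S_def by (intro PiE_mono) auto
  qed (use A in \<open>auto simp: finite_PiE\<close>)
  also have "\<dots> = T h + (\<Sum>f\<in>S - {h}. T f)"
    using S(1) h by (rule sum.remove)
  also have "(\<Sum>f\<in>S - {h}. T f) \<le> of_nat (card (S - {h})) * (9 * 128 ^ d)"
    using T_le by (intro sum_bounded_above) auto
  also have "\<dots> \<le> of_nat (card S) * (9 * 128 ^ d)"
    using S(1) by (intro mult_right_mono of_nat_mono card_mono) auto
  also have "\<dots> = 9 * 256 ^ d"
    using power_mult_distrib[of "2::real" 128 d] by (simp add: S(2))
  also have "T h + 9 * 256 ^ d < 0"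
  proof -
    \<comment> \<open>Multiplied by \<open>64\<close>, the claim
      \<open>9 * 256 ^ d < 112 * 1024 ^ (d - 1)\<close> becomes
      \<open>576 * 256 ^ d < 7 * 1024 ^ d\<close>, hence \<open>576 < 7 * 4 ^ d\<close>. This holds
      for \<open>d \<ge> 4\<close> but fails for \<open>d = 2\<close>.\<close>
    have "(4::real) ^ 4 \<le> 4 ^ d"
      using d(1) by (intro power_increasing) auto
    then have "(576::real) < 7 * 4 ^ d"
      by simp
    then have "576 * 256 ^ d < 7 * 4 ^ d * (256 ^ d :: real)"
      by (intro mult_strict_right_mono) auto
    also have "7 * 4 ^ d * (256 ^ d :: real) = 7 * (4 ^ d * 256 ^ d)"
      by (rule mult.assoc)
    also have "4 ^ d * 256 ^ d = (1024 ^ d :: real)"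
      using power_mult_distrib[of "4::real" 256 d] by simp
    also have "\<dots> = 1024 * 1024 ^ (d - 1)"
      using d(1) by (cases d) auto
    finally show ?thesis
      unfolding Th by linarith
  qed
  finally show ?thesis
    by simp
qed

section \<open>Varying the measure of part \<open>0\<close>\<close>

text \<open>By the product rule one vertex at a time gets the differentiated weight. The symmetry of
  the two sides turns the terms of the second side into those of the first, whence the factor
  \<open>2\<close>.\<close>

lemma crown_sum_has_derivative:
  assumes A: "finite A"
    and w: "\<And>k. ((\<lambda>z. w z k) has_real_derivative w' k) (at z)"
    and K: "\<And>x y. K x y = K y x"
  shows "((\<lambda>z. crown_sum A (\<lambda>_. w z) (\<lambda>_. w z) K) has_real_derivative
    2 * (\<Sum>v\<in>A. crown_sum A (\<lambda>i. if i = v then w' else w z) (\<lambda>_. w z) K)) (at z)"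
proof -
  have prod': "((\<lambda>z. \<Prod>i\<in>A. w z (f i)) has_real_derivative
      (\<Sum>v\<in>A. \<Prod>i\<in>A. (if i = v then w' else w z) (f i))) (at z)" for f
  proof -
    have "(\<Prod>i\<in>A. (if i = v then w' else w z) (f i)) = w' (f v) * (\<Prod>i\<in>A - {v}. w z (f i))"
      if "v \<in> A" for v
      using A that by (simp add: prod.remove[of A v])
    then show ?thesis
      using has_field_derivative_prod[of A "\<lambda>i z. w z (f i)" "\<lambda>i. w' (f i)" z] w by simp
  qed
  have "((\<lambda>z. crown_sum A (\<lambda>_. w z) (\<lambda>_. w z) K) has_real_derivative
      (\<Sum>v\<in>A. crown_sum A (\<lambda>i. if i = v then w' else w z) (\<lambda>_. w z) K)
      + (\<Sum>v\<in>A. crown_sum A (\<lambda>_. w z) (\<lambda>i. if i = v then w' else w z) K)) (at z)"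
    unfolding crown_sum_def sum.swap[of _ _ A] sum.distrib[symmetric]
    by (intro DERIV_sum)
      (auto intro!: derivative_eq_intros prod' simp: sum_distrib_left sum_distrib_right sum.distrib algebra_simps)
  then show ?thesis
    by (simp add: crown_sum_swap[OF A K, of "\<lambda>_. w z"])
qed

text \<open>The derivative at \<open>0\<close> is negative, and continuity keeps the value positive
  nearby. Positivity matters because the norm takes an absolute value.\<close>

lemma crown_sum_test_decreases:
  assumes A: "finite A" "odd (card A)" "card A > 3"
  obtains z where "z > 0" "0 < crown_sum A (\<lambda>_. test_weight z) (\<lambda>_. test_weight z) test_kernel"
    "crown_sum A (\<lambda>_. test_weight z) (\<lambda>_. test_weight z) test_kernel
      < crown_sum A (\<lambda>_. test_weight 0) (\<lambda>_. test_weight 0) test_kernel"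
proof -
  define S where "S z = crown_sum A (\<lambda>_. test_weight z) (\<lambda>_. test_weight z) test_kernel" for z
  define D where "D = 2 * (\<Sum>v\<in>A. crown_sum A
    (\<lambda>i. if i = v then (\<lambda>k. of_bool (k = 0)) else test_weight 0) (\<lambda>_. test_weight 0) test_kernel)"
  have S': "(S has_real_derivative D) (at 0)"
    unfolding S_def[abs_def] D_def
    by (intro crown_sum_has_derivative A(1) test_kernel_sym)
      (auto simp: test_weight_def intro!: derivative_eq_intros)
  have "(\<Sum>v\<in>A. crown_sum A (\<lambda>i. if i = v then (\<lambda>k. of_bool (k = 0)) else test_weight 0)
      (\<lambda>_. test_weight 0) test_kernel) < (\<Sum>v\<in>A. 0)"
  proof (rule sum_strict_mono)
    fix v assume "v \<in> A"
    then show "crown_sum A (\<lambda>i. if i = v then (\<lambda>k. of_bool (k = 0)) else test_weight 0)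
      (\<lambda>_. test_weight 0) test_kernel < 0"
      by (rule crown_sum_test_neg[OF A])
  qed (use A in auto)
  then have "D < 0"
    by (simp add: D_def)
  from DERIV_neg_dec_right[OF S' this] obtain e where e: "e > 0" "\<And>z. 0 < z \<Longrightarrow> z < e \<Longrightarrow> S z < S 0"
    by auto
  have "S 0 > 0"
    unfolding S_def by (rule crown_sum_test_pos[OF A(1,2)])
  then have "\<forall>\<^sub>F z in at 0. S z > 0"
    using DERIV_isCont[OF S'] by (intro order_tendstoD(1)) (auto simp: isCont_def)
  then obtain e' where e': "e' > 0" "\<And>z. z \<noteq> 0 \<Longrightarrow> \<bar>z\<bar> < e' \<Longrightarrow> S z > 0"
    by (auto simp: eventually_at)
  show ?thesis
    using e e' that[of "min e e' / 2"] unfolding S_def by auto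
qed

section \<open>Step kernels on the unit square\<close>

definition part :: "real \<Rightarrow> real \<Rightarrow> real \<Rightarrow> nat" where
  "part p q x = (if x < p then 0 else if x < q then 1 else 2)"

definition part_weight :: "real \<Rightarrow> real \<Rightarrow> nat \<Rightarrow> real" where
  "part_weight p q k = (if k = 0 then p else if k = 1 then q - p else 1 - q)"

definition step_kernel :: "real \<Rightarrow> real \<Rightarrow> (nat \<Rightarrow> nat \<Rightarrow> real) \<Rightarrow> real \<times> real \<Rightarrow> real" where
  "step_kernel p q K = (\<lambda>(x, y). K (part p q x) (part p q y))"

lemma part_less_3: "part p q x < 3"
  by (simp add: part_def)

lemma part_measurable [measurable]: "part p q \<in> unit_measure \<rightarrow>\<^sub>M count_space UNIV"
proof -
  have "part p q \<in> lborel \<rightarrow>\<^sub>M count_space UNIV"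
    unfolding part_def[abs_def] by measurable
  then show ?thesis
    by (rule measurable_restrict_space1)
qed

lemma step_kernel_in_kernels:
  assumes "\<And>x y. K x y = K y x"
  shows "step_kernel p q K \<in> kernels"
proof -
  have "(\<lambda>z. K (part p q (fst z)) (part p q (snd z))) \<in> borel_measurable (unit_measure \<Otimes>\<^sub>M unit_measure)"
    by measurable
  \<comment> \<open>A step kernel takes at most nine values; the sum of their absolute values is a
    bound.\<close>
  moreover have "\<bar>K (part p q x) (part p q y)\<bar> \<le> (\<Sum>a<3. \<Sum>b<3. \<bar>K a b\<bar>)" for x y
  proof -
    have "\<bar>K (part p q x) (part p q y)\<bar> \<le> (\<Sum>b<3. \<bar>K (part p q x) b\<bar>)"
      by (rule member_le_sum) (auto simp: part_less_3)
    also have "\<dots> \<le> (\<Sum>a<3. \<Sum>b<3. \<bar>K a b\<bar>)"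
      by (rule member_le_sum) (auto simp: part_less_3 sum_nonneg)
    finally show ?thesis .
  qed
  ultimately show ?thesis
    using assms unfolding kernels_def step_kernel_def
    by (auto simp: case_prod_unfold simp del: sum.lessThan_Suc)
qed

lemma sigma_finite_unit_measure: "sigma_finite_measure unit_measure"
proof -
  have "finite_measure unit_measure"
    by (intro finite_measureI) (simp add: emeasure_restrict_space space_restrict_space)
  then show ?thesis
    by (rule finite_measure.axioms)
qed

lemma integral_part:
  assumes "0 \<le> p" "p \<le> q" "q \<le> 1" "k < 3"
  shows "integrable unit_measure (\<lambda>x. of_bool (part p q x = k) :: real)"
    and "(LINT x|unit_measure. of_bool (part p q x = k)) = part_weight p q k"
proof -
  define I where "I = (if k = 0 then {0..<p} else if k = 1 then {p..<q} else {q..1})"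
  have eq: "indicator {0..1} x * of_bool (part p q x = k) = (indicator I x :: real)" for x
    using assms by (auto simp: part_def I_def indicator_def numeral_eq_Suc less_Suc_eq)
  have I: "I \<in> sets lborel" "emeasure lborel I < \<infinity>" "measure lborel I = part_weight p q k"
    using assms by (auto simp: I_def part_weight_def)
  show "integrable unit_measure (\<lambda>x. of_bool (part p q x = k) :: real)"
    using I by (simp add: integrable_restrict_space eq)
  show "(LINT x|unit_measure. of_bool (part p q x = k)) = part_weight p q k"
    using I by (simp add: integral_restrict_space eq)
qed

section \<open>The graph without its matching, and its density for step kernels\<close>

text \<open>The vertex \<open>m j\<close> is the partner of \<open>j\<close>. Listing edges by
  ordered pairs off the diagonal turns a product over edges into the double product of
  \<open>crown_sum\<close>.\<close>

definition crown :: "'a set \<Rightarrow> ('a \<Rightarrow> 'a) \<Rightarrow> 'a ugraph" where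
  "crown A m = (A \<union> m ` A, (\<lambda>(i, j). {i, m j}) ` (SIGMA i:A. A - {i}))"

text \<open>The sides are disjoint, so an edge determines its end in \<open>A\<close>, and
  injectivity of \<open>m\<close> recovers the other index.\<close>

lemma crown_edges_inj:
  assumes "inj_on m A" "A \<inter> m ` A = {}"
  shows "inj_on (\<lambda>(i, j). {i, m j}) (SIGMA i:A. A - {i})"
  using assms by (fastforce simp: inj_on_def doubleton_eq_iff)

text \<open>The matching is the graph of a bijection. Uniqueness at vertices of \<open>A\<close>
  shows that it has no edges besides \<open>{a, m a}\<close>; at vertices of \<open>B\<close>,
  uniqueness gives injectivity and existence gives surjectivity.\<close>

lemma delete_perfect_matching_crown:
  assumes "A \<inter> B = {}" and M: "perfect_matching (complete_bipartite A B) M"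
  obtains m where "bij_betw m A B" "delete_edges (complete_bipartite A B) M = crown A m"
proof -
  have sub: "\<exists>a\<in>A. \<exists>b\<in>B. e = {a, b}" if "e \<in> M" for e
    using M that unfolding perfect_matching_def complete_bipartite_def by fastforce
  have ex1: "\<exists>!e. e \<in> M \<and> v \<in> e" if "v \<in> A \<union> B" for v
    using M that unfolding perfect_matching_def complete_bipartite_def by auto
  have "\<exists>b\<in>B. {a, b} \<in> M" if a: "a \<in> A" for a
  proof -
    from ex1[of a] a obtain e where e: "e \<in> M" "a \<in> e"
      by blast
    then obtain a' b where "a' \<in> A" "b \<in> B" "e = {a', b}"
      using sub by blast
    then show ?thesis
      using e a assms(1) by auto
  qed
  then obtain m where m: "\<And>a. a \<in> A \<Longrightarrow> m a \<in> B" "\<And>a. a \<in> A \<Longrightarrow> {a, m a} \<in> M"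
    by metis
  have uniq: "b = m a" if "a \<in> A" "b \<in> B" "{a, b} \<in> M" for a b
  proof -
    have "{a, b} = {a, m a}"
      using ex1[of a] that m(2)[of a] by blast
    then show ?thesis
      by (auto simp: doubleton_eq_iff)
  qed
  have "inj_on m A"
  proof (rule inj_onI)
    fix a a' assume a: "a \<in> A" "a' \<in> A" "m a = m a'"
    have "{a, m a} = {a', m a}"
      using ex1[of "m a"] m(1)[of a] m(2)[of a] m(2)[of a'] a by auto
    then show "a = a'"
      by (auto simp: doubleton_eq_iff)
  qed
  moreover have "m ` A = B"
  proof
    show "B \<subseteq> m ` A"
    proof
      fix b assume b: "b \<in> B"
      from ex1[of b] b obtain e where e: "e \<in> M" "b \<in> e"
        by blast
      then obtain a b' where ab: "a \<in> A" "b' \<in> B" "e = {a, b'}"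
        using sub by blast
      then have "b = b'"
        using e b assms(1) by auto
      then show "b \<in> m ` A"
        using uniq[of a b] ab e by auto
    qed
  qed (use m in auto)
  ultimately have bij: "bij_betw m A B"
    by (simp add: bij_betw_def)
  have "{{a, b} |a b. a \<in> A \<and> b \<in> B} - M = (\<lambda>(i, j). {i, m j}) ` (SIGMA i:A. A - {i})" (is "?L = ?R")
  proof
    show "?L \<subseteq> ?R"
    proof
      fix e assume e: "e \<in> ?L"
      then obtain a b where ab: "a \<in> A" "b \<in> B" "e = {a, b}"
        by blast
      then obtain j where "j \<in> A" "b = m j"
        using \<open>m ` A = B\<close> by blast
      moreover have "j \<noteq> a"
        using e ab m(2) calculation by auto
      ultimately show "e \<in> ?R"
        using ab by (auto intro!: rev_image_eqI[of "(a, j)"])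
    qed
    show "?R \<subseteq> ?L"
    proof
      fix e assume "e \<in> ?R"
      then obtain i j where ij: "i \<in> A" "j \<in> A" "j \<noteq> i" and e: "e = {i, m j}"
        by auto
      have "{i, m j} \<notin> M"
        using uniq[of i "m j"] ij m(1) \<open>inj_on m A\<close> by (auto simp: inj_on_eq_iff)
      then show "e \<in> ?L"
        using ij m(1) unfolding e by blast
    qed
  qed
  then have "delete_edges (complete_bipartite A B) M = crown A m"
    unfolding crown_def delete_edges_def complete_bipartite_def using \<open>m ` A = B\<close> by simp
  with bij show ?thesis
    by (rule that)
qed

text \<open>The integrand depends only on the parts containing the coordinates. It is expanded over
  all assignments of parts, and the integral of each product of indicators factors into part
  measures.\<close>

lemma t_H_crown_step:
  assumes A: "finite A" "inj_on m A" "A \<inter> m ` A = {}" and pq: "0 \<le> p" "p \<le> q" "q \<le> 1"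
    and K: "\<And>x y. K x y = K y x"
  shows "t_H (crown A m) (step_kernel p q K)
    = crown_sum A (\<lambda>_. part_weight p q) (\<lambda>_. part_weight p q) K"
proof -
  interpret product_sigma_finite "\<lambda>_. unit_measure"
    by (rule product_sigma_finite.intro) (rule sigma_finite_unit_measure)
  define V where "V = A \<union> m ` A"
  have V: "finite V"
    using A(1) by (simp add: V_def)
  \<comment> \<open>The indicator that the coordinate at \<open>v\<close> lies in the part
    prescribed by \<open>f\<close> or, carried over by \<open>m\<close>, by \<open>g\<close>. A
    single family over \<open>V\<close> fits the integral of a product over a product
    measure.\<close>
  define h where "h f g v x = (of_bool (part p q x = (if v \<in> A then f v else g (the_inv_into A m v))) :: real)"
    for f g :: "'a \<Rightarrow> nat" and v x
  have split: "(\<Prod>v\<in>V. F v) = (\<Prod>i\<in>A. F i) * (\<Prod>j\<in>A. F (m j))" for F :: "'a \<Rightarrow> real"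
    unfolding V_def using A by (simp add: prod.union_disjoint prod.reindex)
  have mA: "m j \<notin> A" if "j \<in> A" for j
    using A(3) that by auto
  define c where "c f g = (\<Prod>i\<in>A. \<Prod>j\<in>A - {i}. K (f i) (g j))" for f g :: "'a \<Rightarrow> nat"
  have hprod: "(\<Prod>v\<in>V. h f g v (x v)) =
      (\<Prod>i\<in>A. of_bool (part p q (x i) = f i)) * (\<Prod>j\<in>A. of_bool (part p q (x (m j)) = g j))" for f g x
    unfolding split h_def using mA by (simp add: the_inv_into_f_f[OF A(2)] cong: prod.cong)
  \<comment> \<open>A product of indicators selects a single map; the restriction to
    \<open>A\<close> matches the extensionality of \<open>f\<close>.\<close>
  have delta: "(\<Prod>i\<in>A. of_bool (y i = f i)) = (of_bool (f = restrict y A) :: real)"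
    if f: "f \<in> A \<rightarrow>\<^sub>E {..<3}" for f y :: "'a \<Rightarrow> nat"
  proof (cases "f = restrict y A")
    case False
    then obtain i where "i \<in> A" "y i \<noteq> f i"
      using extensionalityI[of f A "restrict y A"] f by (force simp: PiE_iff)
    then have "(\<Prod>i\<in>A. of_bool (y i = f i)) = (0::real)"
      using A(1) by (intro prod_zero) auto
    then show ?thesis
      using False by simp
  qed simp
  have pointwise: "(\<Prod>e\<in>edges (crown A m). edge_value (step_kernel p q K) x e)
      = (\<Sum>f\<in>A \<rightarrow>\<^sub>E {..<3}. \<Sum>g\<in>A \<rightarrow>\<^sub>E {..<3}. c f g * (\<Prod>v\<in>V. h f g v (x v)))"
    if x: "x \<in> space (\<Pi>\<^sub>M v\<in>V. unit_measure)" for x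
  proof -
    let ?f = "\<lambda>i\<in>A. part p q (x i)" and ?g = "\<lambda>j\<in>A. part p q (x (m j))"
    have x01: "x v \<in> {0..1}" if "v \<in> V" for v
      using x that by (auto simp: space_PiM space_restrict_space PiE_iff)
    have "(\<Prod>e\<in>edges (crown A m). edge_value (step_kernel p q K) x e)
        = (\<Prod>(i, j)\<in>(SIGMA i:A. A - {i}). edge_value (step_kernel p q K) x {i, m j})"
      unfolding crown_def snd_conv prod.reindex[OF crown_edges_inj[OF A(2,3)]]
      by (simp add: case_prod_unfold)
    also have "\<dots> = (\<Prod>(i, j)\<in>(SIGMA i:A. A - {i}). K (part p q (x i)) (part p q (x (m j))))"
    proof (intro prod.cong refl)
      fix r assume "r \<in> (SIGMA i:A. A - {i})"
      then obtain i j where r: "r = (i, j)" and "i \<in> A" "j \<in> A"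
        by blast
      then have "x i \<in> {0..1}" "x (m j) \<in> {0..1}"
        using x01 by (auto simp: V_def)
      then have "edge_value (step_kernel p q K) x {i, m j} = K (part p q (x i)) (part p q (x (m j)))"
        by (subst edge_value_pair[OF step_kernel_in_kernels]) (auto simp: K step_kernel_def)
      then show "(case r of (i, j) \<Rightarrow> edge_value (step_kernel p q K) x {i, m j})
          = (case r of (i, j) \<Rightarrow> K (part p q (x i)) (part p q (x (m j))))"
        by (simp add: r)
    qed
    also have "\<dots> = c ?f ?g"
      unfolding c_def using A(1) by (simp add: prod.Sigma[symmetric])
    also have "\<dots> = (\<Sum>f\<in>A \<rightarrow>\<^sub>E {..<3}. \<Sum>g\<in>A \<rightarrow>\<^sub>E {..<3}.
        c f g * (of_bool (f = ?f) * of_bool (g = ?g)))"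
    proof -
      have mem: "?f \<in> A \<rightarrow>\<^sub>E {..<3}" "?g \<in> A \<rightarrow>\<^sub>E {..<3}"
        by (auto simp: part_less_3)
      have fin: "finite (A \<rightarrow>\<^sub>E {..<3::nat})"
        using A(1) by (simp add: finite_PiE)
      have "(\<Sum>f\<in>A \<rightarrow>\<^sub>E {..<3}. \<Sum>g\<in>A \<rightarrow>\<^sub>E {..<3}. c f g * (of_bool (f = ?f) * of_bool (g = ?g)))
          = (\<Sum>f\<in>A \<rightarrow>\<^sub>E {..<3}. if f = ?f then (\<Sum>g\<in>A \<rightarrow>\<^sub>E {..<3}. if g = ?g then c f g else 0) else 0)"
        by (intro sum.cong refl) (auto intro!: sum.cong)
      also have "\<dots> = c ?f ?g"
        using mem by (simp only: sum.delta'[OF fin] sum.delta[OF fin] if_True)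
      finally show ?thesis ..
    qed
    also have "\<dots> = (\<Sum>f\<in>A \<rightarrow>\<^sub>E {..<3}. \<Sum>g\<in>A \<rightarrow>\<^sub>E {..<3}. c f g * (\<Prod>v\<in>V. h f g v (x v)))"
      unfolding hprod
      by (intro sum.cong refl arg_cong2[where f = "(*)"]) (simp_all add: delta)
    finally show ?thesis .
  qed
  have int: "integrable unit_measure (h f g v)" and
    int_eq: "(LINT x|unit_measure. h f g v x)
      = part_weight p q (if v \<in> A then f v else g (the_inv_into A m v))"
    if "f \<in> A \<rightarrow>\<^sub>E {..<3}" "g \<in> A \<rightarrow>\<^sub>E {..<3}" "v \<in> V" for f g v
  proof -
    have "(if v \<in> A then f v else g (the_inv_into A m v)) < 3"
      using that mA by (auto simp: V_def PiE_iff the_inv_into_f_f[OF A(2)])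
    note integral_part[OF pq this]
    then show "integrable unit_measure (h f g v)"
      "(LINT x|unit_measure. h f g v x) = part_weight p q (if v \<in> A then f v else g (the_inv_into A m v))"
      unfolding h_def by auto
  qed
  have "t_H (crown A m) (step_kernel p q K) = (LINT x|(\<Pi>\<^sub>M v\<in>V. unit_measure).
      (\<Sum>f\<in>A \<rightarrow>\<^sub>E {..<3}. \<Sum>g\<in>A \<rightarrow>\<^sub>E {..<3}. c f g * (\<Prod>v\<in>V. h f g v (x v))))"
    unfolding t_H_def using pointwise
    by (intro Bochner_Integration.integral_cong) (auto simp: crown_def V_def)
  also have "\<dots> = (\<Sum>f\<in>A \<rightarrow>\<^sub>E {..<3}. \<Sum>g\<in>A \<rightarrow>\<^sub>E {..<3}.
      (LINT x|(\<Pi>\<^sub>M v\<in>V. unit_measure). c f g * (\<Prod>v\<in>V. h f g v (x v))))"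
  proof -
    have *: "integrable (\<Pi>\<^sub>M v\<in>V. unit_measure) (\<lambda>x. c f g * (\<Prod>v\<in>V. h f g v (x v)))"
      if "f \<in> A \<rightarrow>\<^sub>E {..<3}" "g \<in> A \<rightarrow>\<^sub>E {..<3}" for f g
      using that by (intro integrable_mult_right product_integrable_prod V int)
    show ?thesis
      by (subst Bochner_Integration.integral_sum)
        (intro sum.cong refl Bochner_Integration.integral_sum Bochner_Integration.integrable_sum *;
          assumption)+
  qed
  also have "\<dots> = crown_sum A (\<lambda>_. part_weight p q) (\<lambda>_. part_weight p q) K"
    unfolding crown_sum_def
  proof (intro sum.cong refl)
    fix f g :: "'a \<Rightarrow> nat" assume fg: "f \<in> A \<rightarrow>\<^sub>E {..<3}" "g \<in> A \<rightarrow>\<^sub>E {..<3}"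
    have "(LINT x|(\<Pi>\<^sub>M v\<in>V. unit_measure). (\<Prod>v\<in>V. h f g v (x v)))
        = (\<Prod>v\<in>V. part_weight p q (if v \<in> A then f v else g (the_inv_into A m v)))"
      using product_integral_prod[OF V int[OF fg]] int_eq[OF fg] by simp
    also have "\<dots> = (\<Prod>i\<in>A. part_weight p q (f i)) * (\<Prod>j\<in>A. part_weight p q (g j))"
      unfolding split using mA by (simp add: the_inv_into_f_f[OF A(2)] cong: prod.cong)
    finally show "(LINT x|(\<Pi>\<^sub>M v\<in>V. unit_measure). c f g * (\<Prod>v\<in>V. h f g v (x v))) =
      (\<Prod>i\<in>A. part_weight p q (f i)) * (\<Prod>j\<in>A. part_weight p q (g j)) *
      (\<Prod>i\<in>A. \<Prod>j\<in>A - {i}. K (f i) (g j))"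
      by (simp add: c_def)
  qed
  finally show ?thesis .
qed

section \<open>The two parities of the degree\<close>

text \<open>Definiteness fails: the kernel below vanishes nowhere but has density zero.\<close>

lemma odd_degree_crown_not_norming:
  assumes A: "finite A" "inj_on m A" "A \<inter> m ` A = {}" and "A \<noteq> {}" "odd (card A - 1)"
  shows "\<not> norming (crown A m)"
proof
  assume "norming (crown A m)"
  \<comment> \<open>With \<open>p = 0\<close> and \<open>q = 1/2\<close>, part \<open>0\<close> has
    measure zero and parts \<open>1\<close> and \<open>2\<close> have measure \<open>1/2\<close>
    each, so \<open>s\<close> is balanced.\<close>
  define s where "s k = (if k = 1 then 1 else - 1 :: real)" for k :: nat
  define K where "K x y = s x * s y" for x y
  have K: "K x y = K y x" for x y
    by (simp add: K_def)
  \<comment> \<open>The product contains \<open>s y\<close> to the odd power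
    \<open>card A - 1\<close>, which is \<open>s y\<close>, and the two halves cancel.\<close>
  have "(\<Sum>y<3. part_weight 0 (1/2) y * (\<Prod>i\<in>A - {j}. K (f i) y)) = 0" if "j \<in> A" for f j
    using assms(5) that A(1)
    by (simp add: K_def prod.distrib sum_lessThan_3 part_weight_def s_def)
  then have "crown_sum A (\<lambda>_. part_weight 0 (1/2)) (\<lambda>_. part_weight 0 (1/2)) K = 0"
    using assms(4) A(1) by (subst crown_sum_factor) (auto intro!: sum.neutral)
  then have "norm_H (crown A m) (step_kernel 0 (1/2) K) = 0"
    using t_H_crown_step[OF A, of 0 "1/2" K] K by (simp add: norm_H_def)
  then have "AE z in unit_measure \<Otimes>\<^sub>M unit_measure. step_kernel 0 (1/2) K z = 0"
    using \<open>norming (crown A m)\<close> step_kernel_in_kernels[of K] K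
    unfolding norming_def is_norm_ae_def by blast
  moreover have "step_kernel 0 (1/2) K z \<noteq> 0" for z
    by (simp add: step_kernel_def K_def s_def split: prod.split)
  ultimately have "AE z in unit_measure \<Otimes>\<^sub>M unit_measure. False"
    by simp
  \<comment> \<open>The unit square would be a null set, but its measure is
    \<open>1\<close>.\<close>
  then have "emeasure (unit_measure \<Otimes>\<^sub>M unit_measure) (space unit_measure \<times> space unit_measure) = 0"
    using AE_iff_measurable[OF sets.top, of "unit_measure \<Otimes>\<^sub>M unit_measure" "\<lambda>_. False"]
    unfolding space_pair_measure[symmetric] by simp
  then show False
    using sigma_finite_measure.emeasure_pair_measure_Times[OF sigma_finite_unit_measure sets.top sets.top, of unit_measure]
    by (simp add: emeasure_restrict_space space_restrict_space)
qed

text \<open>The triangle inequality or homogeneity fails: a kernel and its sign change have equal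
  norm, yet their average has larger norm.\<close>

lemma even_degree_crown_not_norming:
  assumes A: "finite A" "inj_on m A" "A \<inter> m ` A = {}" and "card A > 3" "odd (card A)"
  shows "\<not> norming (crown A m)"
proof
  let ?H = "crown A m"
  assume norming: "norming ?H"
  obtain z where z: "z > 0"
    and pos: "0 < crown_sum A (\<lambda>_. test_weight z) (\<lambda>_. test_weight z) test_kernel"
    and less: "crown_sum A (\<lambda>_. test_weight z) (\<lambda>_. test_weight z) test_kernel
      < crown_sum A (\<lambda>_. test_weight 0) (\<lambda>_. test_weight 0) test_kernel"
    using crown_sum_test_decreases[OF A(1) assms(5,4)] by blast
  \<comment> \<open>The weights \<open>z\<close>, \<open>1\<close>, \<open>8\<close> add up to
    \<open>9 + z\<close>; scaling by \<open>c\<close> makes them measures of parts of the unit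
    interval.\<close>
  define c where "c = 1 / (9 + z)"
  define p where "p = c * z"
  define q where "q = c * z + c"
  have c: "c > 0" "c * (9 + z) = 1"
    using z by (auto simp: c_def)
  have pq: "0 \<le> p" "p \<le> q" "q \<le> 1"
    using c z by (auto simp: p_def q_def algebra_simps)
  have weight: "part_weight p q = (\<lambda>k. c * test_weight z k)"
    using c(2) by (auto simp: part_weight_def test_weight_def p_def q_def fun_eq_iff algebra_simps)
  \<comment> \<open>This sign flips part \<open>0\<close>, so \<open>K'\<close> negates the entries
    between part \<open>0\<close> and the rest. As the entry at \<open>(0, 0)\<close> is
    \<open>0\<close>, the average of \<open>test_kernel\<close> and \<open>K'\<close> is
    \<open>K0\<close>.\<close>
  define s where "s k = (if k = 0 then - 1 else 1 :: real)" for k :: nat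
  define K' where "K' x y = s x * s y * test_kernel x y" for x y
  define K0 where "K0 x y = (if x = 0 \<or> y = 0 then 0 else test_kernel x y)" for x y
  have sym: "K' x y = K' y x" "K0 x y = K0 y x" for x y
    using test_kernel_sym[of x y] by (auto simp: K'_def K0_def)
  have t: "t_H ?H (step_kernel p q K)
      = c ^ (2 * card A) * crown_sum A (\<lambda>_. test_weight z) (\<lambda>_. test_weight z) K"
    if "\<And>x y. K x y = K y x" for K
    unfolding t_H_crown_step[OF A pq that] weight crown_sum_scale ..
  have tK': "t_H ?H (step_kernel p q K') = t_H ?H (step_kernel p q test_kernel)"
    unfolding t[OF sym(1)] t[OF test_kernel_sym] K'_def
    by (subst crown_sum_sign) (use A assms(5) in \<open>auto simp: s_def\<close>)
  \<comment> \<open>Assignments using part \<open>0\<close> contribute nothing on either side: on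
    the left each vertex has a neighbour, so some entry of \<open>K0\<close> is \<open>0\<close>; on
    the right the weight is \<open>0\<close>. All other terms agree.\<close>
  have "crown_sum A (\<lambda>_. test_weight z) (\<lambda>_. test_weight z) K0
      = crown_sum A (\<lambda>_. test_weight 0) (\<lambda>_. test_weight 0) test_kernel"
    unfolding crown_sum_def
  proof (intro sum.cong refl)
    fix f g :: "'a \<Rightarrow> nat"
    have other: "\<exists>j. j \<in> A - {i}" if "i \<in> A" for i
    proof -
      have "card (A - {i}) \<noteq> 0"
        using A(1) that assms(4) by simp
      then show ?thesis
        by (metis card.empty ex_in_conv)
    qed
    show "(\<Prod>i\<in>A. test_weight z (f i)) * (\<Prod>j\<in>A. test_weight z (g j)) *
        (\<Prod>i\<in>A. \<Prod>j\<in>A - {i}. K0 (f i) (g j)) =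
      (\<Prod>i\<in>A. test_weight 0 (f i)) * (\<Prod>j\<in>A. test_weight 0 (g j)) *
        (\<Prod>i\<in>A. \<Prod>j\<in>A - {i}. test_kernel (f i) (g j))"
    proof (cases "\<exists>i\<in>A. f i = 0 \<or> g i = 0")
      case True
      then obtain i where i: "i \<in> A" "f i = 0 \<or> g i = 0"
        by blast
      obtain j where j: "j \<in> A" "j \<noteq> i"
        using other[OF i(1)] by auto
      have "\<exists>i\<in>A. \<exists>j\<in>A - {i}. K0 (f i) (g j) = 0"
      proof (cases "f i = 0")
        case True
        then show ?thesis
          using i(1) j by (intro bexI[of _ i] bexI[of _ j]) (auto simp: K0_def)
      next
        case False
        then show ?thesis
          using i j by (intro bexI[of _ j] bexI[of _ i]) (auto simp: K0_def)
      qed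
      then have "(\<Prod>i\<in>A. \<Prod>j\<in>A - {i}. K0 (f i) (g j)) = 0"
        using A(1) by auto
      moreover have "(\<Prod>i\<in>A. test_weight 0 (f i)) * (\<Prod>j\<in>A. test_weight 0 (g j)) = 0"
        using A(1) i by (force simp: test_weight_def)
      ultimately show ?thesis
        by simp
    next
      case False
      then have "test_weight z (f i) = test_weight 0 (f i)" "test_weight z (g i) = test_weight 0 (g i)"
        if "i \<in> A" for i
        using that by (auto simp: test_weight_def)
      moreover have "K0 (f i) (g j) = test_kernel (f i) (g j)" if "i \<in> A" "j \<in> A - {i}" for i j
        using that False by (auto simp: K0_def)
      ultimately show ?thesis
        by simp
    qed
  qed
  then have "0 < t_H ?H (step_kernel p q test_kernel)"
    "t_H ?H (step_kernel p q test_kernel) < t_H ?H (step_kernel p q K0)"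
    unfolding t[OF test_kernel_sym] t[OF sym(2)] using pos less c(1) by auto
  moreover have "card (edges ?H) > 0"
  proof -
    obtain i j where "i \<in> A" "j \<in> A" "i \<noteq> j"
      using card_le_Suc0_iff_eq[OF A(1)] assms(4) by auto
    then have "edges ?H \<noteq> {}"
      by (auto simp: crown_def)
    moreover have "finite (edges ?H)"
      using A(1) by (auto simp: crown_def)
    ultimately show ?thesis
      by (simp add: card_gt_0_iff)
  qed
  ultimately have "norm_H ?H (step_kernel p q test_kernel) < norm_H ?H (step_kernel p q K0)"
    unfolding norm_H_def by (intro powr_less_mono2) auto
  moreover have "norm_H ?H (step_kernel p q K0) \<le> norm_H ?H (step_kernel p q test_kernel)"
  proof -
    define W where "W = step_kernel p q (\<lambda>x y. 1/2 * test_kernel x y)"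
    define W' where "W' = step_kernel p q (\<lambda>x y. 1/2 * K' x y)"
    have mem: "W \<in> kernels" "W' \<in> kernels" "step_kernel p q test_kernel \<in> kernels"
      "step_kernel p q K' \<in> kernels"
      unfolding W_def W'_def by (rule step_kernel_in_kernels; simp add: test_kernel_sym sym(1))+
    have scale: "norm_H ?H (\<lambda>r. a * F r) = \<bar>a\<bar> * norm_H ?H F" if "F \<in> kernels" for F a
      using norming that unfolding norming_def is_norm_ae_def by blast
    have W: "W = (\<lambda>r. 1/2 * step_kernel p q test_kernel r)"
      "W' = (\<lambda>r. 1/2 * step_kernel p q K' r)"
      by (auto simp: W_def W'_def step_kernel_def)
    have half: "norm_H ?H W = \<bar>1/2\<bar> * norm_H ?H (step_kernel p q test_kernel)"
      "norm_H ?H W' = \<bar>1/2\<bar> * norm_H ?H (step_kernel p q K')"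
      unfolding W by (rule scale[OF mem(3)], rule scale[OF mem(4)])
    have "step_kernel p q K0 = (\<lambda>r. W r + W' r)"
      by (auto simp: W_def W'_def step_kernel_def K0_def K'_def s_def test_kernel_def fun_eq_iff)
    then have "norm_H ?H (step_kernel p q K0) \<le> norm_H ?H W + norm_H ?H W'"
      using norming mem unfolding norming_def is_norm_ae_def by simp
    also have "\<dots> = norm_H ?H (step_kernel p q test_kernel)"
      unfolding half by (simp add: norm_H_def tK')
    finally show ?thesis .
  qed
  ultimately show False
    by simp
qed

theorem theorem1p6:
  fixes t :: nat and A B :: "'a set" and M :: "'a set set"
  assumes "t > 3"
    and "finite A" and "finite B" and "card A = t" and "card B = t" and "A \<inter> B = {}"
    and "perfect_matching (complete_bipartite A B) M"
  shows "\<not> norming (delete_edges (complete_bipartite A B) M)"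
proof -
  obtain m where m: "bij_betw m A B" "delete_edges (complete_bipartite A B) M = crown A m"
    using delete_perfect_matching_crown[OF assms(6,7)] .
  then have *: "inj_on m A" "A \<inter> m ` A = {}"
    using assms(6) by (auto simp: bij_betw_def)
  show ?thesis
  \<comment> \<open>Odd \<open>card A\<close> is the case of even degree.\<close>
  proof (cases "odd (card A)")
    case True
    then show ?thesis
      using even_degree_crown_not_norming[OF assms(2) *] assms(1,4) m(2) by simp
  next
    case False
    then have "A \<noteq> {}" "odd (card A - 1)"
      using assms(1,4) by auto
    then show ?thesis
      using odd_degree_crown_not_norming[OF assms(2) *] m(2) by simp
  qed
qed

end
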